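(* Let $\mu$ be a non-atomic probability measure on $[0,1]$ and let $\gamma$ be a non-atomic measure on $\mathbb{R}_+=(0,\infty]$ that is finite on $[t,\infty]$ for every $t>0$. Let $\zeta$ be a Poisson point process on $[0,1]\times\mathbb{R}_+$ with intensity measure $\mu\times\gamma$. Then the distribution of $A(\zeta)$ coincides with $\mu$.
   Context: $\mathbb{R}_+=(0,\infty]$ is the half-line with the point $+\infty$ added, with metric $\rho(x,y)=|1/x-1/y|$ (where $1/\infty=0$); $\gamma$ has no atom at $+\infty$. A point process on $[0,1]\times\mathbb{R}_+$ is identified with its random locally finite configuration of points (finitely many points in $[0,1]\times[t,\infty]$ for every $t>0$). For a configuration $\varkappa$, $A(\varkappa)=\mathrm{argmax}\{x:(t,x)\in\varkappa\}$, that is, the first coordinate $t\in[0,1]$ of the point $(t,x)\in\varkappa$ with the largest second coordinate $x$ (for $\zeta$ this point is a.s. unique whenever the configuration is non-empty).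
   Formalization: If γ has finite total mass, ζ is empty with positive probability and A(ζ) is then undefined; in that case the distribution of A(ζ) is taken conditionally on ζ being non-empty, and for γ=0 no law is claimed. For infinite γ the claim is unconditional. *)

theory Defs
  imports "HOL-Probability.Probability"
begin

text \<open>The half-line with \<open>\<infinity>\<close> added is \<open>{0<..} :: ereal set\<close>.  The map \<open>x \<mapsto> 1/x\<close> carries it,
  with the metric \<open>\<bar>1/x - 1/y\<bar>\<close>, isometrically onto \<open>[0, \<infinity>)\<close>; so this metric induces the
  subspace topology of \<open>ereal\<close>, and the Borel sets are those of \<open>restrict_space borel {0<..}\<close>.\<close>

abbreviation unit_borel :: "real measure" where
  "unit_borel \<equiv> restrict_space borel {0..1}"

abbreviation half_line_borel :: "ereal measure" where
  "half_line_borel \<equiv> restrict_space borel {0<..}"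

text \<open>Atoms are points of positive mass; singletons are measurable in all spaces used here.\<close>

definition non_atomic :: "'a measure \<Rightarrow> bool" where
  "non_atomic N \<longleftrightarrow> (\<forall>x\<in>space N. emeasure N {x} = 0)"

definition num_points :: "'a set \<Rightarrow> 'a set \<Rightarrow> ennreal" where
  "num_points \<kappa> B = emeasure (count_space UNIV) (\<kappa> \<inter> B)"

text \<open>A configuration is encoded as a set of points, so the process is simple.  This loses nothing
  for a diffuse intensity measure such as \<open>\<mu> \<Otimes>\<^sub>M \<gamma>\<close> with non-atomic factors, because the Poisson
  process then has no multiple points almost surely.\<close>

definition locally_finite_config :: "(real \<times> ereal) set \<Rightarrow> bool" where
  "locally_finite_config \<kappa> \<longleftrightarrow>
     \<kappa> \<subseteq> {0..1} \<times> {0<..} \<and> (\<forall>t>0. finite (\<kappa> \<inter> ({0..1} \<times> {t..})))"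

definition poisson_process :: "'w measure \<Rightarrow> 'a measure \<Rightarrow> ('w \<Rightarrow> 'a set) \<Rightarrow> bool" where
  "poisson_process M \<Lambda> Z \<longleftrightarrow>
     prob_space M \<and>
     (\<forall>\<omega>\<in>space M. Z \<omega> \<subseteq> space \<Lambda>) \<and>
     (\<forall>B\<in>sets \<Lambda>. (\<lambda>\<omega>. num_points (Z \<omega>) B) \<in> borel_measurable M) \<and>
     (\<forall>B\<in>sets \<Lambda>. emeasure \<Lambda> B < \<infinity> \<longrightarrow>
        (\<forall>k::nat. measure M {\<omega>\<in>space M. num_points (Z \<omega>) B = of_nat k} =
           measure \<Lambda> B ^ k / fact k * exp (- measure \<Lambda> B))) \<and>
     (\<forall>B\<in>sets \<Lambda>. emeasure \<Lambda> B = \<infinity> \<longrightarrow> (AE \<omega> in M. num_points (Z \<omega>) B = \<infinity>)) \<and>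
     (\<forall>(n::nat) B. disjoint_family_on B {..<n} \<and> (\<forall>i<n. B i \<in> sets \<Lambda>) \<longrightarrow>
        prob_space.indep_vars M (\<lambda>_. borel) (\<lambda>i \<omega>. num_points (Z \<omega>) (B i)) {..<n})"

text \<open>The first coordinate of the point with the largest second coordinate.  The value \<open>0\<close> is a
  convention for configurations without a unique such point (in particular the empty one); it keeps
  the function total with values in \<open>[0, 1]\<close>.\<close>

definition argmax_time :: "(real \<times> ereal) set \<Rightarrow> real" where
  "argmax_time \<kappa> =
     (if \<exists>!p. is_arg_max snd (\<lambda>p. p \<in> \<kappa>) p
      then fst (THE p. is_arg_max snd (\<lambda>p. p \<in> \<kappa>) p) else 0)"

end

theory Submission
  imports Defs
begin

text \<open>The idea is that the marks in $[0,1]$ are independent of the heights and have law \<open>\<mu>\<close>, so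
  looking at the highest point selects a mark without bias.  The proof obtains this from counts in
  boxes only.

  Scan the heights downwards through finitely many levels and stop at the first level above which the
  configuration is not empty.  The event that there is then exactly one point, and that its mark lies
  in \<open>S\<close>, says for a layer \<open>L\<close> of heights and the set \<open>H\<close> of heights above it that
  $[0,1] \times H$ and $([0,1] \setminus S) \times L$ are empty and $S \times L$ holds one point.
  By independence its probability is
  \[ e^{-\gamma(H)} \cdot \mu(S)\gamma(L) e^{-\mu(S)\gamma(L)} \cdot e^{-(1-\mu(S))\gamma(L)}
     = \mu(S) \cdot \gamma(L) e^{-\gamma(L)} e^{-\gamma(H)}, \]
  that is, \<open>\<mu>(S)\<close> times a factor free of \<open>S\<close> (\<open>prob_lone_event_finite\<close>).  Adding levels
  enlarges the event, and along an enumeration of the positive rationals it exhausts the event that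
  the highest point is unique and has its mark in \<open>S\<close>; so the product form passes to the limit
  (\<open>prob_highest_in\<close>).

  It remains to see that a nonempty configuration has a unique highest point almost surely.  Two
  points at the same height lie in the same cell of any partition of the heights, and a cell of mass
  \<open>x\<close> holds two or more points with probability at most \<open>x\<^sup>2\<close>.  As \<open>\<gamma>\<close> is
  diffuse, the heights above a positive level have finite partitions for which the sum of these
  squares is arbitrarily small (\<open>small_sum_of_squares_partition\<close>), so ties have probability
  zero (\<open>AE_unique_highest\<close>).  Hence the event that the process is nonempty and the mark of its
  highest point lies in \<open>S\<close> has probability \<open>\<mu>(S)\<close> times that of being nonempty.\<close>

section \<open>Partitions with a small sum of squares\<close>

text \<open>The sum of squares is the integral of \<open>x \<mapsto> \<nu>(C(x))\<close>, where \<open>C(x)\<close> is the cell of \<open>x\<close>.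
  For the cells cut out by the first \<open>n\<close> sets of a separating sequence, \<open>C(x)\<close> shrinks to \<open>{x}\<close>,
  a null set; dominated convergence sends the integral to zero.\<close>

lemma small_sum_of_squares_partition:
  fixes \<nu> :: "'a measure" and B :: "nat \<Rightarrow> 'a set"
  assumes fin: "finite_measure \<nu>"
    and B: "\<And>i. B i \<in> sets \<nu>"
    and separating: "\<And>x y. x \<in> space \<nu> \<Longrightarrow> y \<in> space \<nu> \<Longrightarrow> x \<noteq> y \<Longrightarrow> \<exists>i. (x \<in> B i) \<noteq> (y \<in> B i)"
    and diffuse: "\<And>x. x \<in> space \<nu> \<Longrightarrow> measure \<nu> {x} = 0"
    and e: "0 < e"
  obtains P where "finite P" "P \<subseteq> sets \<nu>" "\<Union>P = space \<nu>" "(\<Sum>C\<in>P. (measure \<nu> C)\<^sup>2) < e"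
proof -
  interpret finite_measure \<nu> by (fact fin)
  define trace where "trace n x = {i. i < n \<and> x \<in> B i}" for n x
  define cell where "cell n J = {x \<in> space \<nu>. trace n x = J}" for n J
  have cell_sets [measurable]: "cell n J \<in> sets \<nu>" for n J
  proof -
    have "cell n J = {x \<in> space \<nu>. J \<subseteq> {..<n} \<and> (\<forall>i\<in>{..<n}. (x \<in> B i) = (i \<in> J))}"
      by (auto simp: cell_def trace_def)
    also have "\<dots> \<in> sets \<nu>"
      using B by (intro sets.sets_Collect) auto
    finally show ?thesis .
  qed
  define g where "g n x = (\<Sum>J\<in>Pow {..<n}. measure \<nu> (cell n J) * indicator (cell n J) x)" for n x
  have g_eq: "g n x = measure \<nu> (cell n (trace n x))" if "x \<in> space \<nu>" for n x
  proof -
    have "g n x = (\<Sum>J\<in>Pow {..<n}. if trace n x = J then measure \<nu> (cell n J) else 0)"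
      unfolding g_def using that by (intro sum.cong) (auto simp: cell_def)
    also have "\<dots> = measure \<nu> (cell n (trace n x))"
      by (subst sum.delta') (auto simp: trace_def)
    finally show ?thesis .
  qed
  have lim: "(\<lambda>n. g n x) \<longlonglongrightarrow> 0" if x: "x \<in> space \<nu>" for x
  proof -
    have "decseq (\<lambda>n. cell n (trace n x))"
      unfolding decseq_def cell_def trace_def using order_less_le_trans by blast
    then have "(\<lambda>n. measure \<nu> (cell n (trace n x))) \<longlonglongrightarrow> measure \<nu> (\<Inter>n. cell n (trace n x))"
      by (intro finite_Lim_measure_decseq) auto
    moreover have "(\<Inter>n. cell n (trace n x)) = {x}"
    proof -
      have "y = x" if y: "\<And>n. y \<in> cell n (trace n x)" for y
      proof (rule ccontr)
        assume "y \<noteq> x"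
        then obtain i where "(y \<in> B i) \<noteq> (x \<in> B i)"
          using separating[of y x] y x by (auto simp: cell_def)
        then show False
          using y[of "Suc i"] by (auto simp: cell_def trace_def set_eq_iff)
      qed
      then show ?thesis
        using x by (auto simp: cell_def)
    qed
    ultimately show ?thesis
      using diffuse[OF x] g_eq[OF x] by simp
  qed
  have "(\<lambda>n. \<integral>x. g n x \<partial>\<nu>) \<longlonglongrightarrow> (\<integral>x. 0 \<partial>\<nu>)"
  proof (rule integral_dominated_convergence[where w = "\<lambda>_. measure \<nu> (space \<nu>)"])
    show "g n \<in> borel_measurable \<nu>" for n
      unfolding g_def by measurable
    show "AE x in \<nu>. (\<lambda>n. g n x) \<longlonglongrightarrow> 0"
      using lim by (intro AE_I2) auto
    show "AE x in \<nu>. norm (g n x) \<le> measure \<nu> (space \<nu>)" for n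
      by (intro AE_I2) (auto simp: g_eq intro: bounded_measure)
  qed auto
  moreover have "(\<integral>x. g n x \<partial>\<nu>) = (\<Sum>J\<in>Pow {..<n}. (measure \<nu> (cell n J))\<^sup>2)" for n
    unfolding g_def by (subst Bochner_Integration.integral_sum)
      (auto simp: power2_eq_square emeasure_eq_measure intro!: integrable_real_indicator)
  ultimately have "(\<lambda>n. \<Sum>J\<in>Pow {..<n}. (measure \<nu> (cell n J))\<^sup>2) \<longlonglongrightarrow> 0"
    by simp
  from order_tendstoD(2)[OF this e]
  obtain n where n: "(\<Sum>J\<in>Pow {..<n}. (measure \<nu> (cell n J))\<^sup>2) < e"
    unfolding eventually_sequentially by blast
  show thesis
  proof
    show "(\<Union>(cell n ` Pow {..<n})) = space \<nu>"
      by (auto simp: cell_def trace_def)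
    have "(\<Sum>C\<in>cell n ` Pow {..<n}. (measure \<nu> C)\<^sup>2) \<le> (\<Sum>J\<in>Pow {..<n}. (measure \<nu> (cell n J))\<^sup>2)"
      using sum_image_le[of "Pow {..<n}" "\<lambda>C. (measure \<nu> C)\<^sup>2" "cell n"] by (simp add: comp_def)
    then show "(\<Sum>C\<in>cell n ` Pow {..<n}. (measure \<nu> C)\<^sup>2) < e"
      using n by simp
  qed auto
qed

section \<open>Configurations seen through countably many levels\<close>

text \<open>Only density matters; rational levels keep the events below countable unions.\<close>

definition level :: "nat \<Rightarrow> ereal" where
  "level n = ereal (real_of_rat (from_nat_into {q. 0 < q} n))"

lemma level_pos: "0 < level n"
proof -
  have "(1::rat) \<in> {q. 0 < q}"
    by simp
  then have "from_nat_into {q::rat. 0 < q} n \<in> {q. 0 < q}"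
    by (intro from_nat_into) blast
  then show ?thesis
    by (simp add: level_def)
qed

lemma level_dense:
  assumes "0 \<le> x" "x < y"
  shows "\<exists>n. x < level n \<and> level n < y"
proof -
  obtain q :: rat where q: "x < ereal (real_of_rat q)" "ereal (real_of_rat q) < y"
    using ereal_dense3[OF assms(2)] by auto
  with assms(1) have "0 < ereal (real_of_rat q)"
    by (rule_tac le_less_trans)
  then have "q \<in> {q. 0 < q}"
    by simp
  then obtain n where "from_nat_into {q. 0 < q} n = q"
    using from_nat_into_surj[of "{q::rat. 0 < q}" q] by auto
  with q show ?thesis
    by (auto simp: level_def)
qed

lemma num_points_eq_0_iff: "num_points \<kappa> B = 0 \<longleftrightarrow> (\<forall>q\<in>\<kappa>. q \<notin> B)"
proof -
  have "num_points \<kappa> B = 0 \<longleftrightarrow> \<kappa> \<inter> B = {}"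
    unfolding num_points_def by (auto simp: emeasure_count_space)
  then show ?thesis
    by auto
qed

lemma num_points_eq_1_iff:
  "num_points \<kappa> B = 1 \<longleftrightarrow> (\<exists>p\<in>\<kappa>. p \<in> B \<and> (\<forall>q\<in>\<kappa>. q \<in> B \<longrightarrow> q = p))"
proof -
  have "num_points \<kappa> B = 1 \<longleftrightarrow> card (\<kappa> \<inter> B) = Suc 0"
    unfolding num_points_def by (auto simp: emeasure_count_space card_eq_0_iff)
  also have "\<dots> \<longleftrightarrow> (\<exists>p. \<kappa> \<inter> B = {p})"
    by (simp add: card_1_singleton_iff)
  also have "\<dots> \<longleftrightarrow> (\<exists>p\<in>\<kappa>. p \<in> B \<and> (\<forall>q\<in>\<kappa>. q \<in> B \<longrightarrow> q = p))"
    by (simp add: set_eq_iff Bex_def) blast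
  finally show ?thesis .
qed

definition lone_point_above :: "(real \<times> ereal) set \<Rightarrow> real set \<Rightarrow> ereal \<Rightarrow> bool" where
  "lone_point_above \<kappa> S r \<longleftrightarrow>
     (\<exists>p\<in>\<kappa>. fst p \<in> S \<and> r \<le> snd p \<and> (\<forall>q\<in>\<kappa>. r \<le> snd q \<longrightarrow> q = p))"

definition unique_highest :: "(real \<times> ereal) set \<Rightarrow> bool" where
  "unique_highest \<kappa> \<longleftrightarrow> (\<exists>!p. is_arg_max snd (\<lambda>p. p \<in> \<kappa>) p)"

lemma argmax_time_eq_0: "\<not> unique_highest \<kappa> \<Longrightarrow> argmax_time \<kappa> = 0"
  by (simp add: argmax_time_def unique_highest_def)

definition tie_above :: "(real \<times> ereal) set \<Rightarrow> ereal \<Rightarrow> bool" where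
  "tie_above \<kappa> t \<longleftrightarrow> (\<exists>p\<in>\<kappa>. \<exists>q\<in>\<kappa>. p \<noteq> q \<and> snd p = snd q \<and> t \<le> snd p)"

lemma finite_config_above:
  assumes "locally_finite_config \<kappa>" "0 < t"
  shows "finite (\<kappa> \<inter> UNIV \<times> {t..})"
proof -
  have "\<kappa> \<inter> UNIV \<times> {t..} = \<kappa> \<inter> {0..1} \<times> {t..}"
    using assms(1) by (auto simp: locally_finite_config_def)
  then show ?thesis
    using assms by (auto simp: locally_finite_config_def)
qed

text \<open>Local finiteness leaves a gap below a unique highest point, and a rational level fits into it.  This
  expresses the position of the highest point through counts in boxes, which are measurable.\<close>

lemma unique_highest_iff_lone_point_above:
  assumes \<kappa>: "locally_finite_config \<kappa>"
  shows "unique_highest \<kappa> \<and> argmax_time \<kappa> \<in> S \<longleftrightarrow> (\<exists>n. lone_point_above \<kappa> S (level n))"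
proof
  assume "unique_highest \<kappa> \<and> argmax_time \<kappa> \<in> S"
  then have ex1: "\<exists>!p. is_arg_max snd (\<lambda>p. p \<in> \<kappa>) p" and S: "argmax_time \<kappa> \<in> S"
    by (auto simp: unique_highest_def)
  define p where "p = (THE p. is_arg_max snd (\<lambda>p. p \<in> \<kappa>) p)"
  have p: "is_arg_max snd (\<lambda>p. p \<in> \<kappa>) p"
    unfolding p_def using ex1 by (rule theI')
  have p_S: "fst p \<in> S"
    using S ex1 by (simp add: argmax_time_def p_def)
  have p_in: "p \<in> \<kappa>" and p_max: "\<And>w. w \<in> \<kappa> \<Longrightarrow> snd w \<le> snd p"
    using p by (auto simp: is_arg_max_def not_less)
  have lower: "snd w < snd p" if "w \<in> \<kappa>" "w \<noteq> p" for w
  proof (rule ccontr)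
    assume "\<not> snd w < snd p"
    then have "is_arg_max snd (\<lambda>p. p \<in> \<kappa>) w"
      using that(1) p_max unfolding is_arg_max_def
      by (meson leD le_less_linear le_less_trans)
    with ex1 p that(2) show False
      by blast
  qed
  have "0 < snd p"
    using p_in \<kappa> by (auto simp: locally_finite_config_def)
  then obtain k where k: "level k < snd p"
    using level_dense[of 0 "snd p"] by auto
  define W where "W = \<kappa> \<inter> UNIV \<times> {level k..} - {p}"
  have fin: "finite W"
    unfolding W_def using finite_config_above[OF \<kappa> level_pos] by simp
  \<comment> \<open>The second largest height, cut off below at a positive level so that the maximum is over a
    finite nonempty set.\<close>
  define y where "y = Max (insert (level k) (snd ` W))"
  have "y < snd p"
    unfolding y_def using fin k lower by (auto simp: W_def)
  moreover have "level k \<le> y"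
    unfolding y_def using fin by (intro Max_ge) auto
  ultimately obtain n where n: "y < level n" "level n < snd p"
    using level_dense[of y "snd p"] level_pos[of k] by (meson less_le_trans less_imp_le)
  have "w = p" if "w \<in> \<kappa>" "level n \<le> snd w" for w
  proof (rule ccontr)
    assume "w \<noteq> p"
    with that n \<open>level k \<le> y\<close> have "w \<in> W"
      by (cases w) (auto simp: W_def)
    then have "snd w \<le> y"
      unfolding y_def using fin by (intro Max_ge) auto
    with that n show False
      by simp
  qed
  with p_S p_in n show "\<exists>n. lone_point_above \<kappa> S (level n)"
    unfolding lone_point_above_def by (meson less_imp_le)
next
  assume "\<exists>n. lone_point_above \<kappa> S (level n)"
  then obtain n p where p_in: "p \<in> \<kappa>" "level n \<le> snd p" and S: "fst p \<in> S"
    and uniq: "\<And>q. q \<in> \<kappa> \<Longrightarrow> level n \<le> snd q \<Longrightarrow> q = p"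
    unfolding lone_point_above_def by blast
  have lower: "snd w < snd p" if "w \<in> \<kappa>" "w \<noteq> p" for w
    using uniq[OF that(1)] that(2) p_in(2) by (meson le_less_trans not_le)
  have iff: "is_arg_max snd (\<lambda>p. p \<in> \<kappa>) w \<longleftrightarrow> w = p" for w
    using p_in lower unfolding is_arg_max_def by (metis less_asym less_irrefl)
  have "is_arg_max snd (\<lambda>p. p \<in> \<kappa>) = (\<lambda>w. w = p)"
    using iff by (intro ext)
  then show "unique_highest \<kappa> \<and> argmax_time \<kappa> \<in> S"
    using S by (simp add: unique_highest_def argmax_time_def)
qed

text \<open>Only finitely many points are as high as a given one, so a highest point exists, and uniqueness can
  fail only through a tie.\<close>

lemma no_unique_highest_imp_tie:
  assumes \<kappa>: "locally_finite_config \<kappa>" and "\<kappa> \<noteq> {}" and "\<not> unique_highest \<kappa>"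
  shows "\<exists>n. tie_above \<kappa> (level n)"
proof -
  obtain p0 where p0: "p0 \<in> \<kappa>"
    using \<open>\<kappa> \<noteq> {}\<close> by auto
  have "0 < snd p0"
    using p0 \<kappa> by (auto simp: locally_finite_config_def)
  then obtain n where n: "level n < snd p0"
    using level_dense[of 0 "snd p0"] by auto
  define W where "W = \<kappa> \<inter> UNIV \<times> {level n..}"
  have W: "finite W" "p0 \<in> W"
    using finite_config_above[OF \<kappa> level_pos] p0 n by (cases p0; auto simp: W_def)+
  then have "Max (snd ` W) \<in> snd ` W"
    by (intro Max_in) auto
  then obtain p where p: "p \<in> W" "snd p = Max (snd ` W)"
    by auto
  then have W_max: "snd w \<le> snd p" if "w \<in> W" for w
    using W that by auto
  have max: "snd w \<le> snd p" if "w \<in> \<kappa>" for w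
  proof (cases "w \<in> W")
    case False
    with that have "snd w < level n"
      by (cases w) (auto simp: W_def)
    with n W_max[OF W(2)] show ?thesis
      by simp
  qed (rule W_max)
  then have "is_arg_max snd (\<lambda>p. p \<in> \<kappa>) p"
    using p by (auto simp: is_arg_max_def W_def not_less)
  with assms(3) obtain q where "q \<noteq> p" and q: "is_arg_max snd (\<lambda>p. p \<in> \<kappa>) q"
    unfolding unique_highest_def by metis
  moreover have "p \<in> \<kappa>" "level n \<le> snd p"
    using p(1) by (auto simp: W_def mem_Times_iff)
  moreover from q have "q \<in> \<kappa>" "\<not> snd q < snd p"
    using \<open>p \<in> \<kappa>\<close> unfolding is_arg_max_def by blast+
  moreover have "snd q = snd p"
    using max[OF \<open>q \<in> \<kappa>\<close>] \<open>\<not> snd q < snd p\<close> by simp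
  ultimately show ?thesis
    using \<open>q \<noteq> p\<close> unfolding tie_above_def by metis
qed

section \<open>The Poisson process on the strip\<close>

locale poisson_on_strip =
  fixes \<mu> :: "real measure" and \<gamma> :: "ereal measure"
    and M :: "'w measure" and \<zeta> :: "'w \<Rightarrow> (real \<times> ereal) set"
  assumes prob_mark: "prob_space \<mu>"
    and sets_mark: "sets \<mu> = sets unit_borel"
    and sets_height: "sets \<gamma> = sets half_line_borel"
    and diffuse_height: "non_atomic \<gamma>"
    and finite_above: "\<And>t::ereal. t > 0 \<Longrightarrow> emeasure \<gamma> {t..} < \<infinity>"
    and config: "\<And>\<omega>. \<omega> \<in> space M \<Longrightarrow> locally_finite_config (\<zeta> \<omega>)"
    and poisson: "poisson_process M (\<mu> \<Otimes>\<^sub>M \<gamma>) \<zeta>"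
begin

sublocale prob_space M
  using poisson by (simp add: poisson_process_def)

sublocale mark: prob_space \<mu>
  by (rule prob_mark)

lemma space_mark: "space \<mu> = {0..1}"
  using sets_eq_imp_space_eq[OF sets_mark] by (simp add: space_restrict_space)

lemma space_height: "space \<gamma> = {0<..}"
  using sets_eq_imp_space_eq[OF sets_height] by (simp add: space_restrict_space)

lemma sets_height_above: "0 < t \<Longrightarrow> {t..} \<in> sets \<gamma>"
proof -
  assume "0 < t"
  then have "{t..} = {0<..} \<inter> {t..}"
    by auto
  then show "{t..} \<in> sets \<gamma>"
    unfolding sets_height sets_restrict_space by (intro image_eqI[of _ _ "{t..}"]) auto
qed

sublocale height: sigma_finite_measure \<gamma>
proof
  have "(\<Union>n. {level n..}) = space \<gamma>"
  proof -
    have "\<exists>n. level n \<le> x" if "0 < x" for x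
      using level_dense[of 0 x] that by (auto intro: less_imp_le)
    moreover have "0 < x" if "level n \<le> x" for n x
      using level_pos[of n] that by (rule less_le_trans)
    ultimately show ?thesis
      unfolding space_height by blast
  qed
  then show "\<exists>A. countable A \<and> A \<subseteq> sets \<gamma> \<and> \<Union> A = space \<gamma> \<and> (\<forall>a\<in>A. emeasure \<gamma> a \<noteq> \<infinity>)"
    using sets_height_above[OF level_pos] finite_above[OF level_pos]
    by (intro exI[of _ "range (\<lambda>n. {level n..})"]) (auto simp: less_top)
qed

abbreviation N :: "'w \<Rightarrow> (real \<times> ereal) set \<Rightarrow> ennreal" where
  "N \<omega> B \<equiv> num_points (\<zeta> \<omega>) B"

lemma measurable_num_points [measurable]:
  assumes "S \<in> sets \<mu>" "K \<in> sets \<gamma>"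
  shows "(\<lambda>\<omega>. N \<omega> (S \<times> K)) \<in> borel_measurable M"
  using poisson assms by (auto simp: poisson_process_def)

lemma prob_num_points_box:
  fixes k :: nat
  assumes "S \<in> sets \<mu>" "K \<in> sets \<gamma>" "emeasure \<gamma> K < \<infinity>"
  shows "prob {\<omega> \<in> space M. N \<omega> (S \<times> K) = of_nat k} =
    (measure \<mu> S * measure \<gamma> K) ^ k / fact k * exp (- (measure \<mu> S * measure \<gamma> K))"
proof -
  have box: "emeasure (\<mu> \<Otimes>\<^sub>M \<gamma>) (S \<times> K) = emeasure \<mu> S * emeasure \<gamma> K"
    using assms by (simp add: height.emeasure_pair_measure_Times)
  then have "emeasure (\<mu> \<Otimes>\<^sub>M \<gamma>) (S \<times> K) < \<infinity>"
    using assms(3) by (simp add: ennreal_mult_eq_top_iff less_top[symmetric])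
  moreover have "measure (\<mu> \<Otimes>\<^sub>M \<gamma>) (S \<times> K) = measure \<mu> S * measure \<gamma> K"
    by (simp add: measure_def box enn2real_mult)
  ultimately show ?thesis
    using poisson assms by (simp add: poisson_process_def)
qed

lemma prob_three_boxes:
  assumes disj: "B \<inter> C = {}" "B \<inter> D = {}" "C \<inter> D = {}"
    and sets: "B \<in> sets (\<mu> \<Otimes>\<^sub>M \<gamma>)" "C \<in> sets (\<mu> \<Otimes>\<^sub>M \<gamma>)" "D \<in> sets (\<mu> \<Otimes>\<^sub>M \<gamma>)"
  shows "prob {\<omega> \<in> space M. N \<omega> B = b \<and> N \<omega> C = c \<and> N \<omega> D = d} =
    prob {\<omega> \<in> space M. N \<omega> B = b} * prob {\<omega> \<in> space M. N \<omega> C = c} *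
    prob {\<omega> \<in> space M. N \<omega> D = d}"
proof -
  define F where "F i = [B, C, D] ! i" for i
  define v where "v i = [b, c, d] ! i" for i
  have three: "{..<3::nat} = {0, 1, 2}"
    by auto
  have "disjoint_family_on F {..<3}"
    using disj by (auto simp: disjoint_family_on_def three F_def)
  moreover have "\<forall>i<3. F i \<in> sets (\<mu> \<Otimes>\<^sub>M \<gamma>)"
    using sets three by (auto simp: F_def less_Suc_eq numeral_3_eq_3)
  ultimately have "indep_vars (\<lambda>_. borel) (\<lambda>i \<omega>. N \<omega> (F i)) {..<3}"
    using poisson by (auto simp: poisson_process_def)
  from indep_varsD_finite[OF this, of "\<lambda>i. {v i}"]
  have "prob (\<Inter>i\<in>{..<3}. (\<lambda>\<omega>. N \<omega> (F i)) -` {v i} \<inter> space M) =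
      (\<Prod>i<3. prob ((\<lambda>\<omega>. N \<omega> (F i)) -` {v i} \<inter> space M))"
    by (auto simp: lessThan_empty_iff)
  moreover have "(\<Inter>i\<in>{..<3}. (\<lambda>\<omega>. N \<omega> (F i)) -` {v i} \<inter> space M) =
      {\<omega> \<in> space M. N \<omega> B = b \<and> N \<omega> C = c \<and> N \<omega> D = d}"
    by (auto simp: three F_def v_def)
  moreover have "(\<lambda>\<omega>. N \<omega> A) -` {a} \<inter> space M = {\<omega> \<in> space M. N \<omega> A = a}" for A a
    by auto
  ultimately show ?thesis
    by (simp add: three F_def v_def mult.assoc)
qed

lemma lone_point_above_iff_num_points:
  assumes "\<omega> \<in> space M" "S \<subseteq> {0..1}"
  shows "lone_point_above (\<zeta> \<omega>) S r \<longleftrightarrow>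
    N \<omega> (S \<times> {r..}) = 1 \<and> N \<omega> (({0..1} - S) \<times> {r..}) = 0"
proof -
  have marks: "fst q \<in> {0..1}" if "q \<in> \<zeta> \<omega>" for q
    using config[OF assms(1)] that by (auto simp: locally_finite_config_def)
  have "N \<omega> (S \<times> {r..}) = 1 \<longleftrightarrow> (\<exists>p\<in>\<zeta> \<omega>. (fst p \<in> S \<and> r \<le> snd p) \<and>
      (\<forall>q\<in>\<zeta> \<omega>. fst q \<in> S \<and> r \<le> snd q \<longrightarrow> q = p))"
    unfolding num_points_eq_1_iff mem_Times_iff atLeast_iff ..
  moreover have "N \<omega> (({0..1} - S) \<times> {r..}) = 0 \<longleftrightarrow> (\<forall>q\<in>\<zeta> \<omega>. r \<le> snd q \<longrightarrow> fst q \<in> S)"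
    unfolding num_points_eq_0_iff mem_Times_iff atLeast_iff Diff_iff using marks by blast
  ultimately show ?thesis
    unfolding lone_point_above_def by blast
qed

section \<open>The mark of the highest point\<close>

definition lone_event :: "real set \<Rightarrow> ereal set \<Rightarrow> 'w set" where
  "lone_event S Q = {\<omega> \<in> space M. \<exists>r\<in>Q. lone_point_above (\<zeta> \<omega>) S r}"

lemma sets_lone_event:
  assumes S: "S \<in> sets \<mu>" and Q: "countable Q" "\<And>r. r \<in> Q \<Longrightarrow> 0 < r"
  shows "lone_event S Q \<in> sets M"
proof -
  have sub: "S \<subseteq> {0..1}"
    using sets.sets_into_space[OF S] by (simp add: space_mark)
  have S': "{0..1} - S \<in> sets \<mu>"
    using S by (auto simp flip: space_mark)
  have "lone_event S Q = (\<Union>r\<in>Q. {\<omega> \<in> space M. N \<omega> (S \<times> {r..}) = 1 \<and> N \<omega> (({0..1} - S) \<times> {r..}) = 0})"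
    using lone_point_above_iff_num_points[OF _ sub] by (auto simp: lone_event_def)
  also have "\<dots> \<in> sets M"
  proof (rule sets.countable_UN''[OF Q(1)])
    fix r assume "r \<in> Q"
    then have [measurable]: "{r..} \<in> sets \<gamma>"
      using Q sets_height_above by auto
    note S [measurable] S' [measurable]
    show "{\<omega> \<in> space M. N \<omega> (S \<times> {r..}) = 1 \<and> N \<omega> (({0..1} - S) \<times> {r..}) = 0} \<in> sets M"
      by measurable
  qed
  finally show ?thesis .
qed

text \<open>Induction from the top level downwards.  A new lowest level \<open>b\<close> adds the configurations that
  have no point in the heights \<open>H\<close> reached so far and exactly one point, with mark in \<open>S\<close>, in the
  new layer \<open>L\<close>.  This is disjoint from the earlier event, and in its probability the two
  exponentials for \<open>S\<close> and its complement multiply to \<open>exp (- \<gamma>(L))\<close>.\<close>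

lemma prob_lone_event_finite:
  assumes "finite Q" "\<And>r. r \<in> Q \<Longrightarrow> 0 < r"
  shows "\<exists>c. \<forall>S\<in>sets \<mu>. prob (lone_event S Q) = measure \<mu> S * c"
  using assms
proof (induction Q rule: finite_linorder_min_induct)
  case empty
  show ?case
    by (auto simp: lone_event_def intro: exI[of _ 0])
next
  case (insert b Q)
  then obtain c where c: "\<And>S. S \<in> sets \<mu> \<Longrightarrow> prob (lone_event S Q) = measure \<mu> S * c"
    by auto
  define H where "H = (\<Union>r\<in>Q. {r..})"
  define L where "L = {b..} - H"
  have b: "0 < b" "\<And>r. r \<in> Q \<Longrightarrow> b < r" "\<And>r. r \<in> Q \<Longrightarrow> 0 < r"
    using insert by auto
  have H [measurable]: "H \<in> sets \<gamma>"
    unfolding H_def using insert.hyps(1) b(3) sets_height_above by auto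
  then have L [measurable]: "L \<in> sets \<gamma>"
    unfolding L_def using sets_height_above[OF b(1)] by auto
  have "H \<subseteq> {b..}" "L \<subseteq> {b..}"
    using b(2) by (auto simp: H_def L_def intro: less_imp_le less_le_trans)
  then have fin: "emeasure \<gamma> H < \<infinity>" "emeasure \<gamma> L < \<infinity>"
    using finite_above[OF b(1)] emeasure_mono[of _ "{b..}" \<gamma>] sets_height_above[OF b(1)]
    by (meson le_less_trans)+
  have one: "{0..1} \<in> sets \<mu>"
    using sets.top[of \<mu>] by (simp add: space_mark)
  have "prob (lone_event S (insert b Q)) =
      measure \<mu> S * (c + exp (- measure \<gamma> H) * measure \<gamma> L * exp (- measure \<gamma> L))"
    if S: "S \<in> sets \<mu>" for S
  proof -
    have S_sub: "S \<subseteq> {0..1}"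
      using sets.sets_into_space[OF S] by (simp add: space_mark)
    have S': "{0..1} - S \<in> sets \<mu>"
      using S by (auto simp flip: space_mark)
    define E where "E = {\<omega> \<in> space M. N \<omega> ({0..1} \<times> H) = 0 \<and> N \<omega> (S \<times> L) = 1 \<and>
      N \<omega> (({0..1} - S) \<times> L) = 0}"
    have E_sets: "E \<in> sets M"
      unfolding E_def using S S' one by measurable
    have mark_compl: "measure \<mu> ({0..1} - S) = 1 - measure \<mu> S"
      using mark.prob_compl[OF S] by (simp add: space_mark)
    have mark_one: "measure \<mu> {0..1} = 1"
      using mark.prob_space by (simp add: space_mark)
    have boxes: "{0..1} \<times> H \<in> sets (\<mu> \<Otimes>\<^sub>M \<gamma>)" "S \<times> L \<in> sets (\<mu> \<Otimes>\<^sub>M \<gamma>)"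
        "({0..1} - S) \<times> L \<in> sets (\<mu> \<Otimes>\<^sub>M \<gamma>)"
      using S S' one H L by auto
    have "H \<inter> L = {}"
      by (auto simp: L_def)
    then have "prob E = exp (- measure \<gamma> H) *
        (measure \<mu> S * measure \<gamma> L * exp (- (measure \<mu> S * measure \<gamma> L))) *
        exp (- ((1 - measure \<mu> S) * measure \<gamma> L))"
      unfolding E_def using
        prob_num_points_box[OF one H fin(1), of 0] prob_num_points_box[OF S L fin(2), of 1]
        prob_num_points_box[OF S' L fin(2), of 0]
      by (subst prob_three_boxes[OF _ _ _ boxes]) (auto simp: mark_compl mark_one)
    also have "\<dots> = measure \<mu> S * (exp (- measure \<gamma> H) * measure \<gamma> L *
        (exp (- (measure \<mu> S * measure \<gamma> L)) * exp (- ((1 - measure \<mu> S) * measure \<gamma> L))))"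
      by (simp add: mult_ac)
    also have "exp (- (measure \<mu> S * measure \<gamma> L)) * exp (- ((1 - measure \<mu> S) * measure \<gamma> L)) =
        exp (- measure \<gamma> L)"
      by (simp add: algebra_simps flip: exp_add)
    finally have prob_E: "prob E = measure \<mu> S * (exp (- measure \<gamma> H) * measure \<gamma> L * exp (- measure \<gamma> L))" .
    \<comment> \<open>Off the earlier event, a lone point above \<open>b\<close> must lie in the new layer.\<close>
    have new: "lone_point_above (\<zeta> \<omega>) S b \<longleftrightarrow> \<omega> \<in> E"
      if \<omega>: "\<omega> \<in> space M" and none: "\<not> (\<exists>r\<in>Q. lone_point_above (\<zeta> \<omega>) S r)" for \<omega>
    proof
      assume "lone_point_above (\<zeta> \<omega>) S b"
      then obtain p where p: "p \<in> \<zeta> \<omega>" "fst p \<in> S" "b \<le> snd p"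
          and uniq: "\<And>q. q \<in> \<zeta> \<omega> \<Longrightarrow> b \<le> snd q \<Longrightarrow> q = p"
        unfolding lone_point_above_def by blast
      have "snd p \<notin> H"
      proof
        assume "snd p \<in> H"
        then obtain r where r: "r \<in> Q" "r \<le> snd p"
          by (auto simp: H_def)
        then have "lone_point_above (\<zeta> \<omega>) S r"
          unfolding lone_point_above_def using p uniq b(2)[OF r(1)]
          by (meson less_imp_le order_trans)
        with r(1) none show False
          by blast
      qed
      then have "snd p \<in> L"
        using p(3) by (simp add: L_def)
      have uniq': "q = p" if "q \<in> \<zeta> \<omega>" "snd q \<in> H \<union> L" for q
        using that \<open>H \<subseteq> {b..}\<close> \<open>L \<subseteq> {b..}\<close> by (intro uniq) auto
      have "N \<omega> ({0..1} \<times> H) = 0"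
        unfolding num_points_eq_0_iff mem_Times_iff using uniq' \<open>snd p \<notin> H\<close> by (metis UnI1)
      moreover have "N \<omega> (S \<times> L) = 1"
        unfolding num_points_eq_1_iff mem_Times_iff
      proof (intro bexI[OF _ p(1)] conjI ballI impI)
        show "q = p" if "q \<in> \<zeta> \<omega>" "fst q \<in> S \<and> snd q \<in> L" for q
          using that by (intro uniq') auto
      qed (fact p(2) \<open>snd p \<in> L\<close>)+
      moreover have "N \<omega> (({0..1} - S) \<times> L) = 0"
        unfolding num_points_eq_0_iff mem_Times_iff using uniq' p(2) by (metis DiffD2 UnI2)
      ultimately show "\<omega> \<in> E"
        using \<omega> by (simp add: E_def)
    next
      assume "\<omega> \<in> E"
      then have E: "N \<omega> ({0..1} \<times> H) = 0" "N \<omega> (S \<times> L) = 1" "N \<omega> (({0..1} - S) \<times> L) = 0"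
        by (auto simp: E_def)
      from E(2) obtain p where p: "p \<in> \<zeta> \<omega>" "fst p \<in> S" "snd p \<in> L"
          and uniq: "\<And>q. q \<in> \<zeta> \<omega> \<Longrightarrow> fst q \<in> S \<Longrightarrow> snd q \<in> L \<Longrightarrow> q = p"
        unfolding num_points_eq_1_iff mem_Times_iff by blast
      have none: "snd q \<notin> H" if "q \<in> \<zeta> \<omega>" "fst q \<in> {0..1}" for q
        using E(1) that unfolding num_points_eq_0_iff mem_Times_iff by blast
      have none': "fst q \<in> S" if "q \<in> \<zeta> \<omega>" "fst q \<in> {0..1}" "snd q \<in> L" for q
        using E(3) that unfolding num_points_eq_0_iff mem_Times_iff by blast
      have "q = p" if q: "q \<in> \<zeta> \<omega>" "b \<le> snd q" for q
      proof -
        have "fst q \<in> {0..1}"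
          using config[OF \<omega>] q(1) by (auto simp: locally_finite_config_def)
        moreover have "snd q \<in> H \<or> snd q \<in> L"
          using q(2) by (simp add: L_def)
        ultimately show ?thesis
          using uniq[OF q(1)] none[OF q(1)] none'[OF q(1)] by blast
      qed
      moreover have "b \<le> snd p"
        using p(3) \<open>L \<subseteq> {b..}\<close> by auto
      ultimately show "lone_point_above (\<zeta> \<omega>) S b"
        unfolding lone_point_above_def using p by blast
    qed
    have "lone_event S (insert b Q) = lone_event S Q \<union> E"
      using new by (auto simp: lone_event_def E_def)
    moreover have "lone_event S Q \<inter> E = {}"
    proof -
      have False if E: "\<omega> \<in> E" and r: "r \<in> Q" "lone_point_above (\<zeta> \<omega>) S r" for \<omega> r
      proof -
        obtain p where p: "p \<in> \<zeta> \<omega>" "fst p \<in> S" "r \<le> snd p"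
          using r(2) unfolding lone_point_above_def by blast
        then have "p \<in> \<zeta> \<omega> \<and> p \<in> {0..1} \<times> H"
          using S_sub r(1) by (auto simp: H_def mem_Times_iff)
        with E show False
          by (auto simp: E_def num_points_eq_0_iff)
      qed
      then show ?thesis
        by (auto simp: lone_event_def)
    qed
    ultimately show ?thesis
      using c[OF S] prob_E E_sets sets_lone_event[OF S countable_finite[OF insert.hyps(1)] b(3)]
      by (simp add: finite_measure_Union distrib_left)
  qed
  then show ?case
    by blast
qed

definition highest_in :: "real set \<Rightarrow> 'w set" where
  "highest_in S = {\<omega> \<in> space M. unique_highest (\<zeta> \<omega>) \<and> argmax_time (\<zeta> \<omega>) \<in> S}"

lemma highest_in_eq: "highest_in S = lone_event S (range level)"
  unfolding highest_in_def lone_event_def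
  using unique_highest_iff_lone_point_above[OF config] by auto

lemma sets_highest_in: "S \<in> sets \<mu> \<Longrightarrow> highest_in S \<in> sets M"
  unfolding highest_in_eq by (rule sets_lone_event) (auto simp: level_pos)

text \<open>The factor of \<open>\<mu>(S)\<close> for finitely many levels is identified by taking \<open>S\<close> to be the whole
  interval, and both sides increase to their limits as levels are added.\<close>

lemma prob_highest_in:
  assumes S: "S \<in> sets \<mu>"
  shows "prob (highest_in S) = measure \<mu> S * prob (highest_in (space \<mu>))"
proof -
  have lim: "(\<lambda>n. prob (lone_event T (level ` {..<n}))) \<longlonglongrightarrow> prob (highest_in T)"
    if "T \<in> sets \<mu>" for T
  proof -
    have "(\<Union>n. lone_event T (level ` {..<n})) = highest_in T"
      unfolding highest_in_eq by (auto simp: lone_event_def)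
    moreover have "(\<lambda>n. prob (lone_event T (level ` {..<n}))) \<longlonglongrightarrow>
        prob (\<Union>n. lone_event T (level ` {..<n}))"
    proof (rule finite_Lim_measure_incseq)
      show "range (\<lambda>n. lone_event T (level ` {..<n})) \<subseteq> events"
        using level_pos by (auto intro!: sets_lone_event that)
      show "incseq (\<lambda>n. lone_event T (level ` {..<n}))"
        unfolding incseq_def lone_event_def using less_le_trans by blast
    qed
    ultimately show ?thesis
      by simp
  qed
  have "prob (lone_event S (level ` {..<n})) =
      measure \<mu> S * prob (lone_event (space \<mu>) (level ` {..<n}))" for n
  proof -
    obtain c where c: "\<forall>T\<in>sets \<mu>. prob (lone_event T (level ` {..<n})) = measure \<mu> T * c"
      using prob_lone_event_finite[of "level ` {..<n}"] level_pos by auto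
    then show ?thesis
      using S sets.top[of \<mu>] mark.prob_space by auto
  qed
  with lim[OF S] have "(\<lambda>n. measure \<mu> S * prob (lone_event (space \<mu>) (level ` {..<n})))
      \<longlonglongrightarrow> prob (highest_in S)"
    by simp
  moreover have "(\<lambda>n. measure \<mu> S * prob (lone_event (space \<mu>) (level ` {..<n})))
      \<longlonglongrightarrow> measure \<mu> S * prob (highest_in (space \<mu>))"
    by (intro tendsto_mult_left lim) auto
  ultimately show ?thesis
    by (rule LIMSEQ_unique)
qed

section \<open>Absence of ties\<close>

text \<open>From \<open>exp (- x) \<ge> 1 - x\<close>: the probability \<open>1 - (1 + x) exp (- x)\<close> of two or more points is at most
  \<open>1 - (1 + x)(1 - x)\<close>.\<close>

lemma prob_two_points_le:
  assumes K: "K \<in> sets \<gamma>" "emeasure \<gamma> K < \<infinity>"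
  shows "prob {\<omega> \<in> space M. N \<omega> (space \<mu> \<times> K) \<noteq> 0 \<and> N \<omega> (space \<mu> \<times> K) \<noteq> 1} \<le> (measure \<gamma> K)\<^sup>2"
proof -
  define A where "A k = {\<omega> \<in> space M. N \<omega> (space \<mu> \<times> K) = of_nat k}" for k :: nat
  have A_sets: "A k \<in> sets M" for k
    unfolding A_def using K by measurable
  define x where "x = measure \<gamma> K"
  have A_prob: "prob (A k) = x ^ k / fact k * exp (- x)" for k
    unfolding A_def x_def using prob_num_points_box[OF sets.top K, of k] mark.prob_space by simp
  have "{\<omega> \<in> space M. N \<omega> (space \<mu> \<times> K) \<noteq> 0 \<and> N \<omega> (space \<mu> \<times> K) \<noteq> 1} = space M - (A 0 \<union> A 1)"
    by (auto simp: A_def)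
  also have "prob \<dots> = 1 - prob (A 0 \<union> A 1)"
    using A_sets by (intro prob_compl) auto
  also have "prob (A 0 \<union> A 1) = prob (A 0) + prob (A 1)"
    by (intro finite_measure_Union A_sets) (auto simp: A_def)
  also have "1 - (prob (A 0) + prob (A 1)) = 1 - (1 + x) * exp (- x)"
    by (simp add: A_prob distrib_right)
  also have "\<dots> \<le> 1 - (1 + x) * (1 - x)"
    using exp_ge_add_one_self[of "- x"] by (intro diff_left_mono mult_left_mono) (auto simp: x_def)
  also have "\<dots> = x\<^sup>2"
    by (simp add: algebra_simps power2_eq_square)
  finally show ?thesis
    by (simp add: x_def)
qed

text \<open>Tied points fall into one cell, whatever the partition of the heights.  The measurable
  superset is the event that some cell holds two or more points.\<close>

lemma tie_above_small:
  assumes t: "0 < t" and e: "0 < e"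
  shows "\<exists>X. X \<in> sets M \<and> prob X < e \<and>
    {\<omega> \<in> space M. tie_above (\<zeta> \<omega>) t} \<subseteq> X"
proof -
  define \<nu> where "\<nu> = restrict_space \<gamma> {t..}"
  have t_sets: "{t..} \<inter> space \<gamma> \<in> sets \<gamma>"
    using sets_height_above[OF t] by auto
  have space_\<nu>: "space \<nu> = {t..}"
    using t by (auto simp: \<nu>_def space_restrict_space space_height intro: less_le_trans)
  have \<nu>_eq: "emeasure \<nu> K = emeasure \<gamma> K" "measure \<nu> K = measure \<gamma> K" if "K \<subseteq> {t..}" for K
    using that t_sets by (auto simp: \<nu>_def emeasure_restrict_space measure_restrict_space)
  have sets_\<nu>: "K \<in> sets \<nu> \<longleftrightarrow> K \<in> sets \<gamma> \<and> K \<subseteq> {t..}" for K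
    unfolding \<nu>_def using t_sets by (auto simp: sets_restrict_space_iff)
  have diffuse: "measure \<nu> {x} = 0" if "x \<in> space \<nu>" for x
    using that diffuse_height t unfolding space_\<nu>
    by (subst \<nu>_eq) (auto simp: non_atomic_def space_height measure_def less_le_trans)
  have separating: "\<exists>i. (x \<in> {level i..} \<inter> {t..}) \<noteq> (y \<in> {level i..} \<inter> {t..})"
    if xy: "x \<in> space \<nu>" "y \<in> space \<nu>" "x \<noteq> y" for x y
  proof -
    have *: "\<exists>i. u < level i \<and> level i < v" if "u \<in> space \<nu>" "u < v" for u v
      using level_dense[of u v] that t by (auto simp: space_\<nu>)
    from xy(3) consider "x < y" | "y < x"
      unfolding neq_iff by blast
    then show ?thesis
    proof cases
      case 1
      then obtain i where "x < level i" "level i < y"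
        using *[OF xy(1)] by blast
      then have "x \<notin> {level i..} \<inter> {t..}" "y \<in> {level i..} \<inter> {t..}"
        using xy(2) by (auto simp: space_\<nu>)
      then show ?thesis
        by blast
    next
      case 2
      then obtain i where "y < level i" "level i < x"
        using *[OF xy(2)] by blast
      then have "y \<notin> {level i..} \<inter> {t..}" "x \<in> {level i..} \<inter> {t..}"
        using xy(1) by (auto simp: space_\<nu>)
      then show ?thesis
        by blast
    qed
  qed
  have fin: "finite_measure \<nu>"
    using finite_above[OF t] by (intro finite_measureI) (simp add: space_\<nu> \<nu>_eq less_top)
  have B: "{level i..} \<inter> {t..} \<in> sets \<nu>" for i
    using sets_height_above[OF level_pos] sets_height_above[OF t] by (simp add: sets_\<nu>)
  obtain P where P: "finite P" "P \<subseteq> sets \<nu>" "\<Union>P = space \<nu>" "(\<Sum>C\<in>P. (measure \<nu> C)\<^sup>2) < e"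
    by (rule small_sum_of_squares_partition[OF fin B separating diffuse e])
  have P_sets: "C \<in> sets \<gamma>" "C \<subseteq> {t..}" if "C \<in> P" for C
    using that P(2) sets_\<nu> by auto
  have P_fin: "emeasure \<gamma> C < \<infinity>" if "C \<in> P" for C
    using emeasure_mono[OF P_sets(2)[OF that] sets_height_above[OF t]] finite_above[OF t]
    by (rule le_less_trans)
  define D where "D C = {\<omega> \<in> space M. N \<omega> (space \<mu> \<times> C) \<noteq> 0 \<and> N \<omega> (space \<mu> \<times> C) \<noteq> 1}" for C
  have D_sets: "D C \<in> sets M" if "C \<in> P" for C
    unfolding D_def using P_sets[OF that] by measurable
  have tie: "\<omega> \<in> (\<Union>C\<in>P. D C)"
    if \<omega>: "\<omega> \<in> space M" and pq: "p \<in> \<zeta> \<omega>" "q \<in> \<zeta> \<omega>" "p \<noteq> q" "snd p = snd q" "t \<le> snd p" for \<omega> p q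
  proof -
    obtain C where C: "C \<in> P" "snd p \<in> C"
    proof -
      have "snd p \<in> \<Union>P"
        using pq(5) unfolding P(3) space_\<nu> by simp
      then show thesis
        using that by blast
    qed
    have "p \<in> {0..1} \<times> {0<..}" "q \<in> {0..1} \<times> {0<..}"
    proof -
      have "\<zeta> \<omega> \<subseteq> {0..1} \<times> {0<..}"
        using config[OF \<omega>] by (simp add: locally_finite_config_def)
      then show "p \<in> {0..1} \<times> {0<..}" "q \<in> {0..1} \<times> {0<..}"
        using pq(1,2) by blast+
    qed
    then have "p \<in> space \<mu> \<times> C" "q \<in> space \<mu> \<times> C"
      using pq(4) C(2) by (simp_all add: space_mark mem_Times_iff)
    have "\<omega> \<in> D C"
    proof -
      have "N \<omega> (space \<mu> \<times> C) \<noteq> 0"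
        unfolding num_points_eq_0_iff using pq(1) \<open>p \<in> space \<mu> \<times> C\<close> by blast
      moreover have "N \<omega> (space \<mu> \<times> C) \<noteq> 1"
        unfolding num_points_eq_1_iff
        using pq(1-3) \<open>p \<in> space \<mu> \<times> C\<close> \<open>q \<in> space \<mu> \<times> C\<close> by metis
      ultimately show ?thesis
        using \<omega> by (simp add: D_def)
    qed
    with C show ?thesis
      by blast
  qed
  have "prob (\<Union>C\<in>P. D C) \<le> (\<Sum>C\<in>P. prob (D C))"
    using P(1) D_sets by (intro finite_measure_subadditive_finite) auto
  also have "\<dots> \<le> (\<Sum>C\<in>P. (measure \<nu> C)\<^sup>2)"
  proof (rule sum_mono)
    fix C assume "C \<in> P"
    then show "prob (D C) \<le> (measure \<nu> C)\<^sup>2"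
      unfolding D_def \<nu>_eq(2)[OF P_sets(2)[OF \<open>C \<in> P\<close>]] by (intro prob_two_points_le P_sets P_fin)
  qed
  finally have "prob (\<Union>C\<in>P. D C) < e"
    using P(4) by simp
  moreover have "(\<Union>C\<in>P. D C) \<in> sets M"
    using P(1) D_sets by auto
  moreover have "{\<omega> \<in> space M. tie_above (\<zeta> \<omega>) t} \<subseteq> (\<Union>C\<in>P. D C)"
  proof
    fix \<omega> assume "\<omega> \<in> {\<omega> \<in> space M. tie_above (\<zeta> \<omega>) t}"
    then obtain p q where "\<omega> \<in> space M" "p \<in> \<zeta> \<omega>" "q \<in> \<zeta> \<omega>" "p \<noteq> q" "snd p = snd q" "t \<le> snd p"
      unfolding mem_Collect_eq tie_above_def by (elim conjE bexE)
    then show "\<omega> \<in> (\<Union>C\<in>P. D C)"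
      by (rule tie)
  qed
  ultimately have "(\<Union>C\<in>P. D C) \<in> sets M \<and> prob (\<Union>C\<in>P. D C) < e \<and>
      {\<omega> \<in> space M. tie_above (\<zeta> \<omega>) t} \<subseteq> (\<Union>C\<in>P. D C)"
    by (intro conjI)
  then show ?thesis
    by (rule exI)
qed

lemma AE_no_tie:
  assumes t: "0 < t"
  shows "AE \<omega> in M. \<not> tie_above (\<zeta> \<omega>) t"
proof -
  define T where "T = {\<omega> \<in> space M. tie_above (\<zeta> \<omega>) t}"
  have "\<exists>X. X \<in> sets M \<and> prob X < 1 / real (Suc n) \<and> T \<subseteq> X" for n
    unfolding T_def by (rule tie_above_small[OF t]) simp
  then obtain X where X: "\<And>n. X n \<in> sets M" "\<And>n. prob (X n) < 1 / real (Suc n)" "\<And>n. T \<subseteq> X n"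
    by metis
  have inter: "(\<Inter>n. X n) \<in> sets M"
    using X(1) by auto
  have bound: "prob (\<Inter>n. X n) < 1 / real (Suc n)" for n
  proof -
    have "prob (\<Inter>n. X n) \<le> prob (X n)"
      by (intro finite_measure_mono X(1)) auto
    then show ?thesis
      using X(2)[of n] by simp
  qed
  have "prob (\<Inter>n. X n) = 0"
  proof (rule ccontr)
    assume "prob (\<Inter>n. X n) \<noteq> 0"
    then have "0 < prob (\<Inter>n. X n)"
      by (simp add: less_le)
    then obtain n where "inverse (real (Suc n)) < prob (\<Inter>n. X n)"
      using reals_Archimedean by blast
    with bound[of n] show False
      by (simp add: inverse_eq_divide)
  qed
  then have "(\<Inter>n. X n) \<in> null_sets M"
    using inter by (simp add: null_sets_def emeasure_eq_measure)
  then have "AE \<omega> in M. \<omega> \<notin> (\<Inter>n. X n)"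
    by (rule AE_not_in)
  with AE_space show ?thesis
    by eventually_elim (use X(3) in \<open>auto simp: T_def\<close>)
qed

lemma AE_unique_highest: "AE \<omega> in M. \<zeta> \<omega> \<noteq> {} \<longrightarrow> unique_highest (\<zeta> \<omega>)"
proof -
  have "AE \<omega> in M. \<forall>n. \<not> tie_above (\<zeta> \<omega>) (level n)"
    using AE_no_tie[OF level_pos] by (simp add: AE_all_countable)
  with AE_space show ?thesis
  proof eventually_elim
    case (elim \<omega>)
    then show ?case
      using no_unique_highest_imp_tie[OF config[OF elim(1)]] by blast
  qed
qed

section \<open>The law of the time of the maximum\<close>

lemma nonempty_iff:
  assumes "\<omega> \<in> space M"
  shows "\<zeta> \<omega> \<noteq> {} \<longleftrightarrow> N \<omega> (space \<mu> \<times> space \<gamma>) \<noteq> 0"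
proof -
  have "\<zeta> \<omega> \<subseteq> space \<mu> \<times> space \<gamma>"
    using config[OF assms] by (simp add: space_mark space_height locally_finite_config_def)
  then show ?thesis
    unfolding num_points_eq_0_iff by blast
qed

lemma sets_nonempty [measurable]: "{\<omega> \<in> space M. \<zeta> \<omega> \<noteq> {}} \<in> sets M"
proof -
  have "{\<omega> \<in> space M. \<zeta> \<omega> \<noteq> {}} = {\<omega> \<in> space M. N \<omega> (space \<mu> \<times> space \<gamma>) \<noteq> 0}"
    using nonempty_iff by auto
  then show ?thesis
    by simp
qed

lemma argmax_time_in_space:
  assumes \<omega>: "\<omega> \<in> space M"
  shows "argmax_time (\<zeta> \<omega>) \<in> space \<mu>"
proof (cases "unique_highest (\<zeta> \<omega>)")
  case True
  then have ex1: "\<exists>!p. is_arg_max snd (\<lambda>p. p \<in> \<zeta> \<omega>) p"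
    by (simp add: unique_highest_def)
  define p where "p = (THE p. is_arg_max snd (\<lambda>p. p \<in> \<zeta> \<omega>) p)"
  have "p \<in> \<zeta> \<omega>"
    using theI'[OF ex1] by (simp add: is_arg_max_def p_def)
  moreover have "argmax_time (\<zeta> \<omega>) = fst p"
    using ex1 by (simp add: argmax_time_def p_def)
  ultimately show ?thesis
    using config[OF \<omega>] by (auto simp: space_mark locally_finite_config_def)
qed (simp add: argmax_time_eq_0 space_mark)

lemma measurable_argmax_time: "(\<lambda>\<omega>. argmax_time (\<zeta> \<omega>)) \<in> measurable M \<mu>"
proof (rule measurableI)
  fix S assume S: "S \<in> sets \<mu>"
  \<comment> \<open>Without a unique highest point the time is the default value \<open>0\<close>.\<close>
  have "(\<lambda>\<omega>. argmax_time (\<zeta> \<omega>)) -` S \<inter> space M =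
      highest_in S \<union> (if 0 \<in> S then space M - highest_in (space \<mu>) else {})"
  proof (rule set_eqI)
    show "\<omega> \<in> (\<lambda>\<omega>. argmax_time (\<zeta> \<omega>)) -` S \<inter> space M \<longleftrightarrow>
        \<omega> \<in> highest_in S \<union> (if 0 \<in> S then space M - highest_in (space \<mu>) else {})" for \<omega>
      using argmax_time_in_space[of \<omega>]
      by (cases "unique_highest (\<zeta> \<omega>)") (auto simp: highest_in_def argmax_time_eq_0)
  qed
  then show "(\<lambda>\<omega>. argmax_time (\<zeta> \<omega>)) -` S \<inter> space M \<in> sets M"
    using sets_highest_in[OF S] sets_highest_in[OF sets.top] by auto
qed (rule argmax_time_in_space)

abbreviation nonempty :: "'w set" where
  "nonempty \<equiv> {\<omega> \<in> space M. \<zeta> \<omega> \<noteq> {}}"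

text \<open>Up to the null event of a tie, a nonempty configuration has a unique highest point.\<close>

lemma prob_argmax_time_nonempty:
  assumes S: "S \<in> sets \<mu>"
  shows "prob (nonempty \<inter> ((\<lambda>\<omega>. argmax_time (\<zeta> \<omega>)) -` S \<inter> space M)) = measure \<mu> S * prob nonempty"
proof -
  have *: "prob (nonempty \<inter> ((\<lambda>\<omega>. argmax_time (\<zeta> \<omega>)) -` T \<inter> space M)) = prob (highest_in T)"
    if T: "T \<in> sets \<mu>" for T
  proof (rule finite_measure_eq_AE)
    have "unique_highest \<kappa> \<Longrightarrow> \<kappa> \<noteq> {}" for \<kappa>
      by (auto simp: unique_highest_def is_arg_max_def)
    with AE_unique_highest show "AE \<omega> in M. \<omega> \<in> nonempty \<inter> ((\<lambda>\<omega>. argmax_time (\<zeta> \<omega>)) -` T \<inter> space M)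
        \<longleftrightarrow> \<omega> \<in> highest_in T"
      by (auto simp: highest_in_def elim!: eventually_mono)
  qed (use measurable_argmax_time T sets_highest_in in auto)
  have "nonempty \<inter> ((\<lambda>\<omega>. argmax_time (\<zeta> \<omega>)) -` space \<mu> \<inter> space M) = nonempty"
    using argmax_time_in_space by auto
  with *[OF sets.top] have "prob (highest_in (space \<mu>)) = prob nonempty"
    by simp
  then show ?thesis
    using *[OF S] prob_highest_in[OF S] by simp
qed

lemma emeasure_strip: "emeasure (\<mu> \<Otimes>\<^sub>M \<gamma>) (space \<mu> \<times> space \<gamma>) = emeasure \<gamma> (space \<gamma>)"
  by (simp add: height.emeasure_pair_measure_Times mark.emeasure_space_1)

lemma AE_nonempty:
  assumes "emeasure \<gamma> (space \<gamma>) = \<infinity>"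
  shows "AE \<omega> in M. \<zeta> \<omega> \<noteq> {}"
proof -
  have "AE \<omega> in M. N \<omega> (space \<mu> \<times> space \<gamma>) = \<infinity>"
    using poisson emeasure_strip assms sets.top[of "\<mu> \<Otimes>\<^sub>M \<gamma>"]
    by (simp add: poisson_process_def space_pair_measure)
  with AE_space show ?thesis
    by eventually_elim (simp add: nonempty_iff)
qed

lemma prob_nonempty_pos:
  assumes nz: "emeasure \<gamma> (space \<gamma>) \<noteq> 0"
  shows "0 < prob nonempty"
proof (cases "emeasure \<gamma> (space \<gamma>) = \<infinity>")
  case True
  then have "prob nonempty = 1"
    using AE_nonempty by (subst prob_Collect_eq_1) auto
  then show ?thesis
    by simp
next
  case False
  define x where "x = measure \<gamma> (space \<gamma>)"
  have "0 < x"
    using nz False by (simp add: x_def measure_def enn2real_positive_iff less_top zero_less_iff_neq_zero)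
  have "nonempty = space M - {\<omega> \<in> space M. N \<omega> (space \<mu> \<times> space \<gamma>) = of_nat 0}"
    using nonempty_iff by auto
  also have "prob \<dots> = 1 - exp (- x)"
    using prob_num_points_box[of "space \<mu>" "space \<gamma>" 0] False mark.prob_space
    by (subst prob_compl) (auto simp: x_def less_top)
  finally show ?thesis
    using \<open>0 < x\<close> by simp
qed

lemma distr_argmax_time_nonempty:
  assumes "emeasure \<gamma> (space \<gamma>) \<noteq> 0"
  shows "distr (uniform_measure M nonempty) \<mu> (\<lambda>\<omega>. argmax_time (\<zeta> \<omega>)) = \<mu>"
proof (rule measure_eqI)
  fix S assume "S \<in> sets (distr (uniform_measure M nonempty) \<mu> (\<lambda>\<omega>. argmax_time (\<zeta> \<omega>)))"
  then have S: "S \<in> sets \<mu>"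
    by simp
  let ?A = "(\<lambda>\<omega>. argmax_time (\<zeta> \<omega>)) -` S \<inter> space M"
  have A: "?A \<in> sets M"
    using measurable_argmax_time S by (rule measurable_sets)
  have "emeasure (distr (uniform_measure M nonempty) \<mu> (\<lambda>\<omega>. argmax_time (\<zeta> \<omega>))) S =
      emeasure (uniform_measure M nonempty) ?A"
    using measurable_argmax_time S by (subst emeasure_distr) auto
  also have "\<dots> = emeasure M (nonempty \<inter> ?A) / emeasure M nonempty"
    using A by simp
  also have "\<dots> = ennreal (measure \<mu> S * prob nonempty) / ennreal (prob nonempty)"
    unfolding emeasure_eq_measure prob_argmax_time_nonempty[OF S] ..
  also have "\<dots> = emeasure \<mu> S"
    using prob_nonempty_pos[OF assms] by (simp add: divide_ennreal mark.emeasure_eq_measure)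
  finally show "emeasure (distr (uniform_measure M nonempty) \<mu> (\<lambda>\<omega>. argmax_time (\<zeta> \<omega>))) S = emeasure \<mu> S" .
qed simp

lemma distr_argmax_time:
  assumes "emeasure \<gamma> (space \<gamma>) = \<infinity>"
  shows "distr M \<mu> (\<lambda>\<omega>. argmax_time (\<zeta> \<omega>)) = \<mu>"
proof -
  have nonempty: "prob nonempty = 1"
    using AE_nonempty[OF assms] by (subst prob_Collect_eq_1) auto
  have "uniform_measure M nonempty = M"
  proof (rule measure_eqI)
    fix A assume "A \<in> sets (uniform_measure M nonempty)"
    then have A: "A \<in> sets M"
      by simp
    have "emeasure M (nonempty \<inter> A) = emeasure M A"
      using AE_nonempty[OF assms] A by (intro emeasure_eq_AE) auto
    with A nonempty show "emeasure (uniform_measure M nonempty) A = emeasure M A"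
      by (simp add: emeasure_eq_measure[of nonempty] divide_ennreal_def)
  qed simp
  then show ?thesis
    using distr_argmax_time_nonempty assms by simp
qed

end

theorem proposition4:
  fixes \<mu> :: "real measure" and \<gamma> :: "ereal measure"
    and M :: "'w measure" and \<zeta> :: "'w \<Rightarrow> (real \<times> ereal) set"
  assumes "prob_space \<mu>" and "sets \<mu> = sets unit_borel" and "non_atomic \<mu>"
    and "sets \<gamma> = sets half_line_borel" and "non_atomic \<gamma>"
    and "\<And>t::ereal. t > 0 \<Longrightarrow> emeasure \<gamma> {t..} < \<infinity>"
    and "\<And>\<omega>. \<omega> \<in> space M \<Longrightarrow> locally_finite_config (\<zeta> \<omega>)"
    and "poisson_process M (\<mu> \<Otimes>\<^sub>M \<gamma>) \<zeta>"
  shows "(\<lambda>\<omega>. argmax_time (\<zeta> \<omega>)) \<in> measurable M \<mu> \<and>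
    (emeasure \<gamma> (space \<gamma>) = \<infinity> \<longrightarrow>
       (AE \<omega> in M. \<zeta> \<omega> \<noteq> {}) \<and> distr M \<mu> (\<lambda>\<omega>. argmax_time (\<zeta> \<omega>)) = \<mu>) \<and>
    (emeasure \<gamma> (space \<gamma>) \<noteq> 0 \<longrightarrow>
       distr (uniform_measure M {\<omega>\<in>space M. \<zeta> \<omega> \<noteq> {}}) \<mu> (\<lambda>\<omega>. argmax_time (\<zeta> \<omega>)) = \<mu>)"
proof -
  interpret poisson_on_strip \<mu> \<gamma> M \<zeta>
    using assms by (simp add: poisson_on_strip_def)
  show ?thesis
    using measurable_argmax_time AE_nonempty distr_argmax_time distr_argmax_time_nonempty by blast
qed

end
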